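(* If all functors in $\mathcal{F}=(F_s)_{s\in S}$ weakly preserve pullbacks, then the maps $\Sigma^L(-)$ from families of normal lax extensions of $\mathcal{F}$ to normal lax extensions of $\Sigma(\mathcal{F})$, and $c^\ast(-)$ in the opposite direction, are inverse to each other.
   Context: $\mathcal{F}=(F_s)_{s\in S}$ is a family of set functors and $\Sigma(\mathcal{F})X=\sum_{s\in S}F_sX$ with coprojections $c^s_X\colon F_sX\to\Sigma(\mathcal{F})X$. A lax extension of a functor $F$ is a monotone assignment of $Lr\subseteq FX\times FY$ to each relation $r\subseteq X\times Y$ with $Ff\le Lf$, $(Ff)^\circ\le L(f^\circ)$ for all functions $f$, and $Ls\cdot Lr\le L(s\cdot r)$ (applicative relational composition, $^\circ$ = converse); it is normal if $L1_X=1_{FX}$. For a family $\mathcal{L}=(L_s)_{s\in S}$ of (normal) lax extensions with $L_s$ extending $F_s$, $\Sigma^L(\mathcal{L})r=\bigvee_{s\in S}c^s_Y\cdot L_sr\cdot(c^s_X)^\circ$. For a lax extension $L$ of $\Sigma(\mathcal{F})$, $c^\ast(L)_s(r)=(c^s_Y)^\circ\cdot Lr\cdot c^s_X$. Both maps restrict to normal lax extensions and are ordered pointwise. *)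

theory Defs
  imports "HOL-Library.FuncSet" "HOL-Library.Equipollence"
begin

text \<open>
  HOL has no type of all sets, so the category of sets is represented by a collection \<open>\<U>\<close>
  of subsets of a type \<open>'a\<close>, with extensional functions as morphisms. The closure
  conditions ensure finite limits and finite coproducts. Instances: all
  subsets of an infinite type, and the small sets of a type of ZF sets (which gives the full
  category of sets).
\<close>

definition set_universe :: "'a set set \<Rightarrow> bool" where
  "set_universe \<U> \<longleftrightarrow>
     (\<exists>X\<in>\<U>. \<exists>a\<in>X. \<exists>b\<in>X. a \<noteq> b) \<and>
     (\<forall>X\<in>\<U>. \<forall>Y. Y \<lesssim> X \<longrightarrow> Y \<in> \<U>) \<and>
     (\<forall>X\<in>\<U>. \<forall>Y\<in>\<U>. \<exists>P\<in>\<U>. P \<approx> X \<times> Y)"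

lemma set_universe_UNIV:
  assumes "infinite (UNIV :: 'a set)"
  shows "set_universe (UNIV :: 'a set set)"
proof -
  have "UNIV \<noteq> {undefined :: 'a}"
    using assms by (metis finite.emptyI finite_insert)
  then have "\<exists>a b :: 'a. a \<noteq> b"
    by auto
  moreover have "\<exists>P :: 'a set. P \<approx> X \<times> Y" for X Y :: "'a set"
  proof -
    have "X \<times> Y \<lesssim> (UNIV :: 'a set) \<times> (UNIV :: 'a set)"
      by (intro subset_imp_lepoll) auto
    also have "(UNIV :: 'a set) \<times> (UNIV :: 'a set) \<approx> (UNIV :: 'a set)"
      using card_of_Times_same_infinite[OF assms] by (simp add: eqpoll_iff_card_of_ordIso)
    finally obtain h :: "'a \<times> 'a \<Rightarrow> 'a" where "inj_on h (X \<times> Y)"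
      by (auto simp: lepoll_def)
    then have "X \<times> Y \<approx> h ` (X \<times> Y)"
      by (auto simp: eqpoll_def intro: inj_on_imp_bij_betw)
    then show ?thesis
      using eqpoll_sym by blast
  qed
  ultimately show ?thesis
    by (auto simp: set_universe_def)
qed

record ('a, 'b) functor_data =
  ob :: "'a set \<Rightarrow> 'b set"
  mor :: "'a set \<Rightarrow> 'a set \<Rightarrow> ('a \<Rightarrow> 'a) \<Rightarrow> ('b \<Rightarrow> 'b)"

text \<open>
  The values of a functor may live in a different type \<open>'b\<close>, with all subsets of \<open>'b\<close> allowed.
\<close>

definition set_functor :: "'a set set \<Rightarrow> ('a, 'b) functor_data \<Rightarrow> bool" where
  "set_functor \<U> F \<longleftrightarrow>
     (\<forall>X\<in>\<U>. \<forall>Y\<in>\<U>. \<forall>f \<in> X \<rightarrow>\<^sub>E Y. mor F X Y f \<in> ob F X \<rightarrow>\<^sub>E ob F Y) \<and>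
     (\<forall>X\<in>\<U>. mor F X X (\<lambda>x\<in>X. x) = (\<lambda>a\<in>ob F X. a)) \<and>
     (\<forall>X\<in>\<U>. \<forall>Y\<in>\<U>. \<forall>Z\<in>\<U>. \<forall>f \<in> X \<rightarrow>\<^sub>E Y. \<forall>g \<in> Y \<rightarrow>\<^sub>E Z.
        mor F X Z (compose X g f) = compose (ob F X) (mor F Y Z g) (mor F X Y f))"

definition commuting_square ::
  "'a set \<Rightarrow> 'a set \<Rightarrow> 'a set \<Rightarrow> 'a set \<Rightarrow> ('a \<Rightarrow> 'a) \<Rightarrow> ('a \<Rightarrow> 'a) \<Rightarrow> ('a \<Rightarrow> 'a) \<Rightarrow> ('a \<Rightarrow> 'a) \<Rightarrow> bool" where
  "commuting_square P X Y Z p q f g \<longleftrightarrow>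
     p \<in> P \<rightarrow>\<^sub>E X \<and> q \<in> P \<rightarrow>\<^sub>E Y \<and> f \<in> X \<rightarrow>\<^sub>E Z \<and> g \<in> Y \<rightarrow>\<^sub>E Z \<and>
     compose P f p = compose P g q"

definition pullback ::
  "'a set set \<Rightarrow> 'a set \<Rightarrow> 'a set \<Rightarrow> 'a set \<Rightarrow> 'a set \<Rightarrow>
   ('a \<Rightarrow> 'a) \<Rightarrow> ('a \<Rightarrow> 'a) \<Rightarrow> ('a \<Rightarrow> 'a) \<Rightarrow> ('a \<Rightarrow> 'a) \<Rightarrow> bool" where
  "pullback \<U> P X Y Z p q f g \<longleftrightarrow>
     commuting_square P X Y Z p q f g \<and>
     (\<forall>Q\<in>\<U>. \<forall>p' q'. commuting_square Q X Y Z p' q' f g \<longrightarrow>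
        (\<exists>!u. u \<in> Q \<rightarrow>\<^sub>E P \<and> compose Q p u = p' \<and> compose Q q u = q'))"

definition weak_pullback ::
  "'a set set \<Rightarrow> 'a set \<Rightarrow> 'a set \<Rightarrow> 'a set \<Rightarrow> 'a set \<Rightarrow>
   ('a \<Rightarrow> 'a) \<Rightarrow> ('a \<Rightarrow> 'a) \<Rightarrow> ('a \<Rightarrow> 'a) \<Rightarrow> ('a \<Rightarrow> 'a) \<Rightarrow> bool" where
  "weak_pullback \<U> P X Y Z p q f g \<longleftrightarrow>
     commuting_square P X Y Z p q f g \<and>
     (\<forall>Q\<in>\<U>. \<forall>p' q'. commuting_square Q X Y Z p' q' f g \<longrightarrow>
        (\<exists>u. u \<in> Q \<rightarrow>\<^sub>E P \<and> compose Q p u = p' \<and> compose Q q u = q'))"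

definition weakly_preserves_pullbacks :: "'a set set \<Rightarrow> ('a, 'b) functor_data \<Rightarrow> bool" where
  "weakly_preserves_pullbacks \<U> F \<longleftrightarrow>
     (\<forall>P\<in>\<U>. \<forall>X\<in>\<U>. \<forall>Y\<in>\<U>. \<forall>Z\<in>\<U>. \<forall>p q f g. pullback \<U> P X Y Z p q f g \<longrightarrow>
        weak_pullback UNIV (ob F P) (ob F X) (ob F Y) (ob F Z)
          (mor F P X p) (mor F P Y q) (mor F X Z f) (mor F Y Z g))"

definition graph_rel :: "'a set \<Rightarrow> ('a \<Rightarrow> 'b) \<Rightarrow> ('a \<times> 'b) set" where
  "graph_rel X f = {(x, f x) | x. x \<in> X}"

text \<open>A relation from \<open>X\<close> to \<open>Y\<close> carries its domain and codomain.\<close>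

definition typed_rels :: "'a set set \<Rightarrow> ('a set \<times> 'a set \<times> ('a \<times> 'a) set) set" where
  "typed_rels \<U> = {(X, Y, r). X \<in> \<U> \<and> Y \<in> \<U> \<and> r \<subseteq> X \<times> Y}"

type_synonym ('a, 'b) rel_map = "'a set \<times> 'a set \<times> ('a \<times> 'a) set \<Rightarrow> ('b \<times> 'b) set"

text \<open>
  The applicative composite \<open>s \<cdot> r\<close> is \<open>r O s\<close> throughout. Extensionality (\<open>\<Pi>\<^sub>E\<close>) makes
  equality of lax extensions coincide with equality on all typed relations.
\<close>

definition lax_extension :: "'a set set \<Rightarrow> ('a, 'b) functor_data \<Rightarrow> ('a, 'b) rel_map \<Rightarrow> bool" where
  "lax_extension \<U> F L \<longleftrightarrow>
     L \<in> (\<Pi>\<^sub>E (X, Y, r) \<in> typed_rels \<U>. Pow (ob F X \<times> ob F Y)) \<and>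
     (\<forall>X\<in>\<U>. \<forall>Y\<in>\<U>. \<forall>r r'. r \<subseteq> r' \<and> r' \<subseteq> X \<times> Y \<longrightarrow> L (X, Y, r) \<subseteq> L (X, Y, r')) \<and>
     (\<forall>X\<in>\<U>. \<forall>Y\<in>\<U>. \<forall>f \<in> X \<rightarrow>\<^sub>E Y.
        graph_rel (ob F X) (mor F X Y f) \<subseteq> L (X, Y, graph_rel X f) \<and>
        (graph_rel (ob F X) (mor F X Y f))\<inverse> \<subseteq> L (Y, X, (graph_rel X f)\<inverse>)) \<and>
     (\<forall>X\<in>\<U>. \<forall>Y\<in>\<U>. \<forall>Z\<in>\<U>. \<forall>r s. r \<subseteq> X \<times> Y \<and> s \<subseteq> Y \<times> Z \<longrightarrow>
        L (X, Y, r) O L (Y, Z, s) \<subseteq> L (X, Z, r O s))"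

definition normal :: "'a set set \<Rightarrow> ('a, 'b) functor_data \<Rightarrow> ('a, 'b) rel_map \<Rightarrow> bool" where
  "normal \<U> F L \<longleftrightarrow> (\<forall>X\<in>\<U>. L (X, X, Id_on X) = Id_on (ob F X))"

definition normal_lax_extensions :: "'a set set \<Rightarrow> ('a, 'b) functor_data \<Rightarrow> ('a, 'b) rel_map set" where
  "normal_lax_extensions \<U> F = {L. lax_extension \<U> F L \<and> normal \<U> F L}"

definition normal_lax_families ::
  "'a set set \<Rightarrow> 's set \<Rightarrow> ('s \<Rightarrow> ('a, 'b) functor_data) \<Rightarrow> ('s \<Rightarrow> ('a, 'b) rel_map) set" where
  "normal_lax_families \<U> S F = (\<Pi>\<^sub>E s\<in>S. normal_lax_extensions \<U> (F s))"

definition coproduct_functor ::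
  "'s set \<Rightarrow> ('s \<Rightarrow> ('a, 'b) functor_data) \<Rightarrow> ('a, 's \<times> 'b) functor_data" where
  "coproduct_functor S F =
     \<lparr> ob = (\<lambda>X. SIGMA s:S. ob (F s) X),
       mor = (\<lambda>X Y f. \<lambda>(s, a) \<in> (SIGMA s:S. ob (F s) X). (s, mor (F s) X Y f a)) \<rparr>"

text \<open>The graph of the coprojection \<open>c\<^sup>s\<^sub>X\<close>.\<close>

definition coproj ::
  "('s \<Rightarrow> ('a, 'b) functor_data) \<Rightarrow> 's \<Rightarrow> 'a set \<Rightarrow> ('b \<times> ('s \<times> 'b)) set" where
  "coproj F s X = graph_rel (ob (F s) X) (\<lambda>a. (s, a))"

definition sum_extension ::
  "'a set set \<Rightarrow> 's set \<Rightarrow> ('s \<Rightarrow> ('a, 'b) functor_data) \<Rightarrow> ('s \<Rightarrow> ('a, 'b) rel_map) \<Rightarrow>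
   ('a, 's \<times> 'b) rel_map" where
  "sum_extension \<U> S F \<L> =
     (\<lambda>(X, Y, r) \<in> typed_rels \<U>. \<Union>s\<in>S. (coproj F s X)\<inverse> O \<L> s (X, Y, r) O coproj F s Y)"

definition restrict_extension ::
  "'a set set \<Rightarrow> 's set \<Rightarrow> ('s \<Rightarrow> ('a, 'b) functor_data) \<Rightarrow> ('a, 's \<times> 'b) rel_map \<Rightarrow>
   ('s \<Rightarrow> ('a, 'b) rel_map)" where
  "restrict_extension \<U> S F L =
     (\<lambda>s\<in>S. \<lambda>(X, Y, r) \<in> typed_rels \<U>. coproj F s X O L (X, Y, r) O (coproj F s Y)\<inverse>)"

end

theory Submission
  imports Defs
begin

text \<open>
  The only point with content is that a normal lax extension \<open>L\<close> of a coproduct never relates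
  elements of different summands. For \<open>r \<subseteq> X \<times> Y\<close> and the unique maps \<open>f : X \<rightarrow> 1\<close>, \<open>g : Y \<rightarrow> 1\<close>,
  the relation \<open>g \<cdot> r \<cdot> f\<degree>\<close> is contained in the identity on \<open>1\<close>, so normality forces \<open>L r\<close>-related
  elements to have equal images in the value at \<open>1\<close>, and functor maps preserve the summand.
\<close>

section \<open>Elementwise descriptions of the relations involved\<close>

lemma typed_rels_iff [simp]: "(X, Y, r) \<in> typed_rels \<U> \<longleftrightarrow> X \<in> \<U> \<and> Y \<in> \<U> \<and> r \<subseteq> X \<times> Y"
  by (simp add: typed_rels_def)

lemma ob_coproduct_functor [simp]: "ob (coproduct_functor S F) X = (SIGMA s:S. ob (F s) X)"
  by (simp add: coproduct_functor_def)

lemma mor_coproduct_functor [simp]: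
  "s \<in> S \<Longrightarrow> a \<in> ob (F s) X \<Longrightarrow> mor (coproduct_functor S F) X Y f (s, a) = (s, mor (F s) X Y f a)"
  by (simp add: coproduct_functor_def)

lemma mem_graph_rel_iff [simp]: "(x, y) \<in> graph_rel X f \<longleftrightarrow> x \<in> X \<and> y = f x"
  by (auto simp: graph_rel_def)

lemma graph_rel_subset: "f \<in> X \<rightarrow>\<^sub>E Y \<Longrightarrow> graph_rel X f \<subseteq> X \<times> Y"
  by (auto simp: graph_rel_def)

lemma mem_coproj_iff [simp]: "(a, p) \<in> coproj F s X \<longleftrightarrow> a \<in> ob (F s) X \<and> p = (s, a)"
  by (simp add: coproj_def)

text \<open>Coprojections are injective with disjoint images, so the tag of an element determines
  which member of the union over \<open>S\<close> can relate it, and at most one does.\<close>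

lemma mem_sum_extension_iff:
  assumes "(X, Y, r) \<in> typed_rels \<U>"
  shows "((s, a), (t, b)) \<in> sum_extension \<U> S F \<L> (X, Y, r) \<longleftrightarrow>
    s \<in> S \<and> t = s \<and> a \<in> ob (F s) X \<and> b \<in> ob (F s) Y \<and> (a, b) \<in> \<L> s (X, Y, r)"
  using assms by (auto simp: sum_extension_def relcomp_unfold)

text \<open>Composing with a coprojection on one side and its converse on the other only attaches
  the tag \<open>s\<close> to both elements.\<close>

lemma mem_restrict_extension_iff:
  assumes "(X, Y, r) \<in> typed_rels \<U>" "s \<in> S"
  shows "(a, b) \<in> restrict_extension \<U> S F L s (X, Y, r) \<longleftrightarrow>
    a \<in> ob (F s) X \<and> b \<in> ob (F s) Y \<and> ((s, a), (s, b)) \<in> L (X, Y, r)"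
  using assms by (auto simp: restrict_extension_def relcomp_unfold)

section \<open>The axioms of functors and lax extensions in terms of elements\<close>

lemma set_functor_mor:
  assumes "set_functor \<U> F" "X \<in> \<U>" "Y \<in> \<U>" "f \<in> X \<rightarrow>\<^sub>E Y" "a \<in> ob F X"
  shows "mor F X Y f a \<in> ob F Y"
  using assms unfolding set_functor_def by (blast dest: PiE_mem)

lemma lax_extension_subset:
  assumes "lax_extension \<U> F L" "(X, Y, r) \<in> typed_rels \<U>"
  shows "L (X, Y, r) \<subseteq> ob F X \<times> ob F Y"
proof -
  have "L \<in> (\<Pi>\<^sub>E (X, Y, r) \<in> typed_rels \<U>. Pow (ob F X \<times> ob F Y))"
    using assms(1) by (simp add: lax_extension_def)
  from PiE_mem[OF this assms(2)] show ?thesis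
    by simp
qed

text \<open>The extensional product in the definition fixes the value off the typed relations. This
  is what allows two lax extensions to be proved equal as total HOL functions.\<close>

lemma lax_extension_arbitrary:
  assumes "lax_extension \<U> F L" "R \<notin> typed_rels \<U>"
  shows "L R = undefined"
proof -
  have "L \<in> (\<Pi>\<^sub>E (X, Y, r) \<in> typed_rels \<U>. Pow (ob F X \<times> ob F Y))"
    using assms(1) by (simp add: lax_extension_def)
  then show ?thesis
    using assms(2) by (rule PiE_arb)
qed

lemma lax_extension_mono:
  assumes "lax_extension \<U> F L" "X \<in> \<U>" "Y \<in> \<U>" "r \<subseteq> r'" "r' \<subseteq> X \<times> Y"
  shows "L (X, Y, r) \<subseteq> L (X, Y, r')"
  using assms by (simp add: lax_extension_def)

lemma lax_extension_graph:
  assumes "lax_extension \<U> F L" "X \<in> \<U>" "Y \<in> \<U>" "f \<in> X \<rightarrow>\<^sub>E Y" "a \<in> ob F X"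
  shows "(a, mor F X Y f a) \<in> L (X, Y, graph_rel X f)"
    and "(mor F X Y f a, a) \<in> L (Y, X, (graph_rel X f)\<inverse>)"
proof -
  have "graph_rel (ob F X) (mor F X Y f) \<subseteq> L (X, Y, graph_rel X f)"
    "(graph_rel (ob F X) (mor F X Y f))\<inverse> \<subseteq> L (Y, X, (graph_rel X f)\<inverse>)"
    using assms(1-4) by (simp_all add: lax_extension_def)
  then show "(a, mor F X Y f a) \<in> L (X, Y, graph_rel X f)"
    and "(mor F X Y f a, a) \<in> L (Y, X, (graph_rel X f)\<inverse>)"
    using assms(5) by auto
qed

lemma lax_extension_relcomp:
  assumes "lax_extension \<U> F L" "X \<in> \<U>" "Y \<in> \<U>" "Z \<in> \<U>" "r \<subseteq> X \<times> Y" "s \<subseteq> Y \<times> Z"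
    and "(a, b) \<in> L (X, Y, r)" "(b, c) \<in> L (Y, Z, s)"
  shows "(a, c) \<in> L (X, Z, r O s)"
proof -
  have "L (X, Y, r) O L (Y, Z, s) \<subseteq> L (X, Z, r O s)"
    using assms(1-6) by (simp add: lax_extension_def)
  then show ?thesis
    using assms(7,8) by blast
qed

text \<open>Restates the inclusions between relations as facts about single pairs, so that the
  membership criteria for the two constructions apply directly.\<close>

lemma lax_extensionI:
  assumes "\<And>X Y r. (X, Y, r) \<in> typed_rels \<U> \<Longrightarrow> L (X, Y, r) \<subseteq> ob F X \<times> ob F Y"
    and "\<And>R. R \<notin> typed_rels \<U> \<Longrightarrow> L R = undefined"
    and "\<And>X Y r r'. X \<in> \<U> \<Longrightarrow> Y \<in> \<U> \<Longrightarrow> r \<subseteq> r' \<Longrightarrow> r' \<subseteq> X \<times> Y \<Longrightarrow> L (X, Y, r) \<subseteq> L (X, Y, r')"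
    and "\<And>X Y f a. X \<in> \<U> \<Longrightarrow> Y \<in> \<U> \<Longrightarrow> f \<in> X \<rightarrow>\<^sub>E Y \<Longrightarrow> a \<in> ob F X \<Longrightarrow>
      (a, mor F X Y f a) \<in> L (X, Y, graph_rel X f) \<and>
      (mor F X Y f a, a) \<in> L (Y, X, (graph_rel X f)\<inverse>)"
    and "\<And>X Y Z r s a b c. X \<in> \<U> \<Longrightarrow> Y \<in> \<U> \<Longrightarrow> Z \<in> \<U> \<Longrightarrow> r \<subseteq> X \<times> Y \<Longrightarrow> s \<subseteq> Y \<times> Z \<Longrightarrow>
      (a, b) \<in> L (X, Y, r) \<Longrightarrow> (b, c) \<in> L (Y, Z, s) \<Longrightarrow> (a, c) \<in> L (X, Z, r O s)"
  shows "lax_extension \<U> F L"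
  unfolding lax_extension_def
proof (intro conjI ballI allI impI)
  show "L \<in> (\<Pi>\<^sub>E (X, Y, r) \<in> typed_rels \<U>. Pow (ob F X \<times> ob F Y))"
  proof (rule PiE_I)
    fix R assume "R \<in> typed_rels \<U>"
    then show "L R \<in> (case R of (X, Y, r) \<Rightarrow> Pow (ob F X \<times> ob F Y))"
      using assms(1) by (cases R) (simp only: prod.case Pow_iff)
  qed (rule assms(2))
next
  fix X Y r r' assume "X \<in> \<U>" "Y \<in> \<U>" "r \<subseteq> r' \<and> r' \<subseteq> X \<times> Y"
  then show "L (X, Y, r) \<subseteq> L (X, Y, r')"
    using assms(3) by simp
next
  fix X Y f assume *: "X \<in> \<U>" "Y \<in> \<U>" "f \<in> X \<rightarrow>\<^sub>E Y"
  show "graph_rel (ob F X) (mor F X Y f) \<subseteq> L (X, Y, graph_rel X f)"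
    and "(graph_rel (ob F X) (mor F X Y f))\<inverse> \<subseteq> L (Y, X, (graph_rel X f)\<inverse>)"
    using assms(4)[OF *] by auto
next
  fix X Y Z r s assume "X \<in> \<U>" "Y \<in> \<U>" "Z \<in> \<U>" "r \<subseteq> X \<times> Y \<and> s \<subseteq> Y \<times> Z"
  then show "L (X, Y, r) O L (Y, Z, s) \<subseteq> L (X, Z, r O s)"
    using assms(5) by blast
qed

section \<open>Normality separates the summands\<close>

text \<open>Supplies the terminal object. A singleton inside an inhabited member of the universe
  injects into that member, and the universe is closed under injections.\<close>

lemma set_universe_singleton:
  assumes "set_universe \<U>"
  obtains e where "{e} \<in> \<U>"
proof -
  from assms obtain X e where "X \<in> \<U>" "e \<in> X"
    unfolding set_universe_def by blast
  moreover from this have "{e} \<lesssim> X"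
    by (intro subset_imp_lepoll) simp
  ultimately have "{e} \<in> \<U>"
    using assms unfolding set_universe_def by blast
  then show ?thesis ..
qed

lemma normal_lax_extension_same_summand:
  assumes "set_universe \<U>" "lax_extension \<U> (coproduct_functor S F) L"
    and "normal \<U> (coproduct_functor S F) L"
    and "(X, Y, r) \<in> typed_rels \<U>" "((s, a), (t, b)) \<in> L (X, Y, r)"
  shows "s = t"
proof -
  let ?F = "coproduct_functor S F"
  obtain e where e: "{e} \<in> \<U>"
    using set_universe_singleton[OF assms(1)] .
  define f where "f = (\<lambda>x\<in>X. e)"
  define g where "g = (\<lambda>y\<in>Y. e)"
  have f: "f \<in> X \<rightarrow>\<^sub>E {e}" and g: "g \<in> Y \<rightarrow>\<^sub>E {e}"
    by (simp_all add: f_def g_def)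
  note XY = assms(4)[simplified]
  have ob: "(s, a) \<in> ob ?F X" "(t, b) \<in> ob ?F Y"
    using lax_extension_subset[OF assms(2,4)] assms(5) by blast+
  \<comment> \<open>Lax functoriality transports the related pair to its images over
    \<open>{e}\<close>: composing with the converse graph of \<open>f\<close> moves the left
    element, and composing with the graph of \<open>g\<close> afterwards moves the right
    one.\<close>
  have "(mor ?F X {e} f (s, a), (t, b)) \<in> L ({e}, Y, (graph_rel X f)\<inverse> O r)"
    using lax_extension_relcomp[OF assms(2) e _ _ _ _ lax_extension_graph(2)[OF assms(2) _ e f ob(1)] assms(5)]
      XY graph_rel_subset[OF f] by blast
  moreover have "(graph_rel X f)\<inverse> O r \<subseteq> {e} \<times> Y"
    using XY graph_rel_subset[OF f] by blast
  ultimately have "(mor ?F X {e} f (s, a), mor ?F Y {e} g (t, b))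
      \<in> L ({e}, {e}, ((graph_rel X f)\<inverse> O r) O graph_rel Y g)"
    using lax_extension_relcomp[OF assms(2) e _ e _ _ _ lax_extension_graph(1)[OF assms(2) _ e g ob(2)]]
      XY graph_rel_subset[OF g] by blast
  moreover have "((graph_rel X f)\<inverse> O r) O graph_rel Y g \<subseteq> Id_on {e}"
    by (auto simp: f_def g_def)
  ultimately have "(mor ?F X {e} f (s, a), mor ?F Y {e} g (t, b)) \<in> L ({e}, {e}, Id_on {e})"
    using lax_extension_mono[OF assms(2) e e, of _ "Id_on {e}"] by blast
  also have "L ({e}, {e}, Id_on {e}) = Id_on (ob ?F {e})"
    using assms(3) e by (simp add: normal_def)
  finally have "mor ?F X {e} f (s, a) = mor ?F Y {e} g (t, b)"
    unfolding Id_on_iff by simp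
  \<comment> \<open>Both elements lie in the coproduct object, where \<open>mor\<close> keeps the
    tag, so equal images have equal first components.\<close>
  then show ?thesis
    using ob by auto
qed

section \<open>Both constructions yield normal lax extensions\<close>

lemma sum_extension_arbitrary: "R \<notin> typed_rels \<U> \<Longrightarrow> sum_extension \<U> S F \<L> R = undefined"
  by (simp add: sum_extension_def)

lemma restrict_extension_arbitrary:
  "s \<in> S \<Longrightarrow> R \<notin> typed_rels \<U> \<Longrightarrow> restrict_extension \<U> S F L s R = undefined"
  by (simp add: restrict_extension_def)

lemma normal_lax_familiesD:
  assumes "\<L> \<in> normal_lax_families \<U> S F" "s \<in> S"
  shows "lax_extension \<U> (F s) (\<L> s)" "normal \<U> (F s) (\<L> s)"
  using PiE_mem[of \<L> S _ s] assms by (auto simp: normal_lax_families_def normal_lax_extensions_def)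

text \<open>Related pairs share a tag, so each axiom for the sum reduces to the same axiom for one
  \<open>\<L> s\<close>. The functor law used is that \<open>mor\<close> maps into the target
  object, which keeps the graphs inside the sum.\<close>

lemma sum_extension_normal_lax:
  assumes "\<And>s. s \<in> S \<Longrightarrow> set_functor \<U> (F s)" "\<L> \<in> normal_lax_families \<U> S F"
  shows "sum_extension \<U> S F \<L> \<in> normal_lax_extensions \<U> (coproduct_functor S F)"
proof -
  note L = normal_lax_familiesD[OF assms(2)]
  let ?L = "sum_extension \<U> S F \<L>"
  have "lax_extension \<U> (coproduct_functor S F) ?L"
  proof (rule lax_extensionI)
    fix X Y r assume "(X, Y, r) \<in> typed_rels \<U>"
    then show "?L (X, Y, r) \<subseteq> ob (coproduct_functor S F) X \<times> ob (coproduct_functor S F) Y"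
      by (auto simp: mem_sum_extension_iff simp del: typed_rels_iff)
  next
    fix R assume "R \<notin> typed_rels \<U>"
    then show "?L R = undefined"
      by (rule sum_extension_arbitrary)
  next
    fix X Y r r'
    assume *: "X \<in> \<U>" "Y \<in> \<U>" "r \<subseteq> r'" "r' \<subseteq> X \<times> Y"
    then have "(X, Y, r) \<in> typed_rels \<U>" "(X, Y, r') \<in> typed_rels \<U>"
      by auto
    then show "?L (X, Y, r) \<subseteq> ?L (X, Y, r')"
      using lax_extension_mono[OF L(1) *, THEN subsetD]
      by (auto simp: mem_sum_extension_iff simp del: typed_rels_iff)
  next
    fix X Y f p
    assume *: "X \<in> \<U>" "Y \<in> \<U>" "f \<in> X \<rightarrow>\<^sub>E Y" and p: "p \<in> ob (coproduct_functor S F) X"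
    have "(X, Y, graph_rel X f) \<in> typed_rels \<U>" "(Y, X, (graph_rel X f)\<inverse>) \<in> typed_rels \<U>"
      using * graph_rel_subset[OF *(3)] by auto
    then show "(p, mor (coproduct_functor S F) X Y f p) \<in> ?L (X, Y, graph_rel X f) \<and>
        (mor (coproduct_functor S F) X Y f p, p) \<in> ?L (Y, X, (graph_rel X f)\<inverse>)"
      using p * lax_extension_graph[OF L(1) *] set_functor_mor[OF assms(1) *]
      by (auto simp: mem_sum_extension_iff simp del: typed_rels_iff)
  next
    fix X Y Z r s p q u
    assume *: "X \<in> \<U>" "Y \<in> \<U>" "Z \<in> \<U>" "r \<subseteq> X \<times> Y" "s \<subseteq> Y \<times> Z"
      and pq: "(p, q) \<in> ?L (X, Y, r)" and qu: "(q, u) \<in> ?L (Y, Z, s)"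
    obtain i a j b k c where [simp]: "p = (i, a)" "q = (j, b)" "u = (k, c)"
      by (metis surj_pair)
    have "(X, Y, r) \<in> typed_rels \<U>" "(Y, Z, s) \<in> typed_rels \<U>" "(X, Z, r O s) \<in> typed_rels \<U>"
      using * by auto
    \<comment> \<open>The two memberships force \<open>i = j = k\<close>, so the composition takes
      place inside \<open>\<L> i\<close>.\<close>
    then show "(p, u) \<in> ?L (X, Z, r O s)"
      using pq qu lax_extension_relcomp[OF L(1) *, of i a b c]
      by (auto simp: mem_sum_extension_iff simp del: typed_rels_iff)
  qed
  moreover have "normal \<U> (coproduct_functor S F) ?L"
    unfolding normal_def
  proof
    fix X assume X: "X \<in> \<U>"
    then have *: "(X, X, Id_on X) \<in> typed_rels \<U>"
      by auto
    \<comment> \<open>The diagonal of a disjoint union is the union of the diagonals of its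
      summands.\<close>
    have "\<L> s (X, X, Id_on X) = Id_on (ob (F s) X)" if "s \<in> S" for s
      using L(2)[OF that] X by (simp add: normal_def)
    then show "?L (X, X, Id_on X) = Id_on (ob (coproduct_functor S F) X)"
      by (auto simp: mem_sum_extension_iff[OF *])
  qed
  ultimately show ?thesis
    by (simp add: normal_lax_extensions_def)
qed

text \<open>Each axiom is the one for \<open>L\<close>, read at elements tagged with
  \<open>s\<close>. For composition, the intermediate element already lies in the summand
  \<open>s\<close>.\<close>

lemma restrict_extension_normal_lax:
  assumes "\<And>s. s \<in> S \<Longrightarrow> set_functor \<U> (F s)"
    and "L \<in> normal_lax_extensions \<U> (coproduct_functor S F)"
  shows "restrict_extension \<U> S F L \<in> normal_lax_families \<U> S F"
  unfolding normal_lax_families_def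
proof (rule PiE_I)
  have L: "lax_extension \<U> (coproduct_functor S F) L" "normal \<U> (coproduct_functor S F) L"
    using assms(2) by (simp_all add: normal_lax_extensions_def)
  fix s assume s: "s \<in> S"
  let ?L = "restrict_extension \<U> S F L s"
  have "lax_extension \<U> (F s) ?L"
  proof (rule lax_extensionI)
    fix X Y r assume "(X, Y, r) \<in> typed_rels \<U>"
    then show "?L (X, Y, r) \<subseteq> ob (F s) X \<times> ob (F s) Y"
      using s by (auto simp: mem_restrict_extension_iff simp del: typed_rels_iff)
  next
    fix R assume "R \<notin> typed_rels \<U>"
    then show "?L R = undefined"
      by (rule restrict_extension_arbitrary[OF s])
  next
    fix X Y r r'
    assume *: "X \<in> \<U>" "Y \<in> \<U>" "r \<subseteq> r'" "r' \<subseteq> X \<times> Y"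
    then have "(X, Y, r) \<in> typed_rels \<U>" "(X, Y, r') \<in> typed_rels \<U>"
      by auto
    then show "?L (X, Y, r) \<subseteq> ?L (X, Y, r')"
      using s lax_extension_mono[OF L(1) *, THEN subsetD]
      by (auto simp: mem_restrict_extension_iff simp del: typed_rels_iff)
  next
    fix X Y f a
    assume *: "X \<in> \<U>" "Y \<in> \<U>" "f \<in> X \<rightarrow>\<^sub>E Y" and a: "a \<in> ob (F s) X"
    have "(X, Y, graph_rel X f) \<in> typed_rels \<U>" "(Y, X, (graph_rel X f)\<inverse>) \<in> typed_rels \<U>"
      using * graph_rel_subset[OF *(3)] by auto
    then show "(a, mor (F s) X Y f a) \<in> ?L (X, Y, graph_rel X f) \<and>
        (mor (F s) X Y f a, a) \<in> ?L (Y, X, (graph_rel X f)\<inverse>)"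
      \<comment> \<open>Naturality of the coprojection: the coproduct functor sends
        \<open>(s, a)\<close> to \<open>(s, mor (F s) X Y f a)\<close>.\<close>
      using s a lax_extension_graph[OF L(1) *, of "(s, a)"] set_functor_mor[OF assms(1)[OF s] * a]
      by (auto simp: mem_restrict_extension_iff simp del: typed_rels_iff)
  next
    fix X Y Z r r' a b c
    assume *: "X \<in> \<U>" "Y \<in> \<U>" "Z \<in> \<U>" "r \<subseteq> X \<times> Y" "r' \<subseteq> Y \<times> Z"
      and ab: "(a, b) \<in> ?L (X, Y, r)" and bc: "(b, c) \<in> ?L (Y, Z, r')"
    have "(X, Y, r) \<in> typed_rels \<U>" "(Y, Z, r') \<in> typed_rels \<U>" "(X, Z, r O r') \<in> typed_rels \<U>"
      using * by auto
    then show "(a, c) \<in> ?L (X, Z, r O r')"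
      using s ab bc lax_extension_relcomp[OF L(1) *, of "(s, a)" "(s, b)" "(s, c)"]
      by (auto simp: mem_restrict_extension_iff simp del: typed_rels_iff)
  qed
  moreover have "normal \<U> (F s) ?L"
    unfolding normal_def
  proof
    fix X assume X: "X \<in> \<U>"
    then have *: "(X, X, Id_on X) \<in> typed_rels \<U>"
      by auto
    have "L (X, X, Id_on X) = Id_on (ob (coproduct_functor S F) X)"
      using L(2) X by (simp add: normal_def)
    then show "?L (X, X, Id_on X) = Id_on (ob (F s) X)"
      using s by (auto simp: mem_restrict_extension_iff[OF * s])
  qed
  ultimately show "?L \<in> normal_lax_extensions \<U> (F s)"
    by (simp add: normal_lax_extensions_def)
qed (simp add: restrict_extension_def)

section \<open>The two constructions are mutually inverse\<close>

text \<open>Tagging both elements with \<open>s\<close> selects exactly the component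
  \<open>\<L> s\<close> of the sum, and no pair is lost because \<open>\<L> s\<close> relates only
  elements of the objects of \<open>F s\<close>.\<close>

lemma restrict_sum_extension:
  assumes "\<L> \<in> normal_lax_families \<U> S F"
  shows "restrict_extension \<U> S F (sum_extension \<U> S F \<L>) = \<L>"
proof (rule extensionalityI[of _ S])
  show "\<L> \<in> extensional S"
    using assms by (simp add: normal_lax_families_def PiE_def)
next
  fix s assume s: "s \<in> S"
  note L = normal_lax_familiesD(1)[OF assms s]
  show "restrict_extension \<U> S F (sum_extension \<U> S F \<L>) s = \<L> s"
  proof
    fix R
    show "restrict_extension \<U> S F (sum_extension \<U> S F \<L>) s R = \<L> s R"
    proof (cases "R \<in> typed_rels \<U>")
      case True
      obtain X Y r where R: "R = (X, Y, r)"
        by (rule prod_cases3)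
      with True have *: "(X, Y, r) \<in> typed_rels \<U>"
        by simp
      then show ?thesis
        using s lax_extension_subset[OF L *]
        by (auto simp: R mem_restrict_extension_iff mem_sum_extension_iff simp del: typed_rels_iff)
    next
      \<comment> \<open>Both sides take the default value \<open>undefined\<close> here.\<close>
      case False
      then show ?thesis
        using lax_extension_arbitrary[OF L] restrict_extension_arbitrary[OF s] by simp
    qed
  qed
qed (simp add: restrict_extension_def)

text \<open>Restricting and summing again keeps exactly the pairs of \<open>L\<close> with equal
  tags. Normality enters through \<open>normal_lax_extension_same_summand\<close>, by which
  \<open>L\<close> has no other pairs.\<close>

lemma sum_restrict_extension:
  assumes "set_universe \<U>" "L \<in> normal_lax_extensions \<U> (coproduct_functor S F)"
  shows "sum_extension \<U> S F (restrict_extension \<U> S F L) = L"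
proof
  have L: "lax_extension \<U> (coproduct_functor S F) L" "normal \<U> (coproduct_functor S F) L"
    using assms(2) by (simp_all add: normal_lax_extensions_def)
  fix R
  show "sum_extension \<U> S F (restrict_extension \<U> S F L) R = L R"
  proof (cases "R \<in> typed_rels \<U>")
    case True
    obtain X Y r where R: "R = (X, Y, r)"
      by (rule prod_cases3)
    with True have *: "(X, Y, r) \<in> typed_rels \<U>"
      by simp
    have "((s, a), (t, b)) \<in> sum_extension \<U> S F (restrict_extension \<U> S F L) (X, Y, r) \<longleftrightarrow>
        ((s, a), (t, b)) \<in> L (X, Y, r)" for s a t b
      using lax_extension_subset[OF L(1) *]
        normal_lax_extension_same_summand[OF assms(1) L *, of s a t b]
      by (auto simp: mem_sum_extension_iff[OF *] mem_restrict_extension_iff[OF *])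
    then show ?thesis
      unfolding R by auto
  next
    case False
    then show ?thesis
      using lax_extension_arbitrary[OF L(1)] sum_extension_arbitrary by metis
  qed
qed

theorem theorem43:
  fixes \<U> :: "'a set set" and S :: "'s set" and F :: "'s \<Rightarrow> ('a, 'b) functor_data"
  assumes "set_universe \<U>"
    and "\<And>s. s \<in> S \<Longrightarrow> set_functor \<U> (F s)"
    and "\<And>s. s \<in> S \<Longrightarrow> weakly_preserves_pullbacks \<U> (F s)"
  shows "sum_extension \<U> S F \<in>
           normal_lax_families \<U> S F \<rightarrow> normal_lax_extensions \<U> (coproduct_functor S F) \<and>
         restrict_extension \<U> S F \<in>
           normal_lax_extensions \<U> (coproduct_functor S F) \<rightarrow> normal_lax_families \<U> S F \<and>
         (\<forall>\<L> \<in> normal_lax_families \<U> S F.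
            restrict_extension \<U> S F (sum_extension \<U> S F \<L>) = \<L>) \<and>
         (\<forall>L \<in> normal_lax_extensions \<U> (coproduct_functor S F).
            sum_extension \<U> S F (restrict_extension \<U> S F L) = L)"
  using assms(1) sum_extension_normal_lax[of S \<U> F, OF assms(2)]
    restrict_extension_normal_lax[of S \<U> F, OF assms(2)]
    restrict_sum_extension sum_restrict_extension
  by blast

end
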